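(* Let $n$ be an odd positive integer, let $a \in \mathbf{F}_q$ be a nonzero element that is a square in $\mathbf{F}_q$, and let $\sqrt{a} \in \mathbf{F}_q$ denote a square root of $a$. Let $f(x)=\sum_{i=0}^n b_i x^i \in \mathbf{F}_q[x]$ be an $a$-self reciprocal monic polynomial of degree $n$. (1) If $b_0 = (\sqrt{a})^n$, then $f(x)$ is divisible by $x+\sqrt{a}$. (2) If $b_0 = -(\sqrt{a})^n$, then $f(x)$ is divisible by $x-\sqrt{a}$.
   Context: Let $q=p^e$ be an odd prime power and $\mathbf{F}_q$ the finite field with $q$ elements. For a nonzero $a\in\mathbf{F}_q$ and a monic polynomial $f(x)=\sum_{i=0}^n b_i x^i \in \mathbf{F}_q[x]$ of degree $n$ with $f(0)\neq 0$, the $a$-reciprocal of $f$ is $\hat{f}_a(x) := \frac{x^n}{f(0)} f\left(\frac{a}{x}\right) = \frac{1}{b_0}\sum_{i=0}^n b_i a^i x^{n-i}$. A monic polynomial $f(x)$ (with $f(0)\ne 0$) is $a$-self reciprocal if $\hat{f}_a(x)=f(x)$; equivalently $b_{n-i}b_0=b_i a^i$ for each $i$. *)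

theory Defs
  imports
    "HOL-Computational_Algebra.Polynomial"
    "HOL-Computational_Algebra.Primes"
    "HOL-Library.Cardinality"
begin

(* The polynomial x^n / f(0) * f(a / x) with n = degree f, cleared of denominators.
   Only meaningful for a and f(0) nonzero. *)
definition a_reciprocal :: "'k::field \<Rightarrow> 'k poly \<Rightarrow> 'k poly" where
  "a_reciprocal a f =
     smult (1 / coeff f 0) (\<Sum>i\<le>degree f. monom (coeff f i * a ^ i) (degree f - i))"

lemma poly_a_reciprocal:
  assumes "x \<noteq> 0"
  shows "poly (a_reciprocal a f) x = x ^ degree f / poly f 0 * poly f (a / x)"
proof -
  have "a ^ i * x ^ (degree f - i) = x ^ degree f * (a / x) ^ i" if "i \<le> degree f" for i
    using assms that by (simp add: power_diff power_divide)
  then have "(\<Sum>i\<le>degree f. coeff f i * a ^ i * x ^ (degree f - i))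
      = x ^ degree f * (\<Sum>i\<le>degree f. coeff f i * (a / x) ^ i)"
    by (auto simp: sum_distrib_left mult.assoc mult.left_commute intro!: sum.cong)
  then show ?thesis
    by (simp add: a_reciprocal_def poly_sum poly_monom poly_altdef[of f "a / x"] poly_0_coeff_0)
qed

definition a_self_reciprocal :: "'k::field \<Rightarrow> 'k poly \<Rightarrow> bool" where
  "a_self_reciprocal a f \<longleftrightarrow>
     lead_coeff f = 1 \<and> coeff f 0 \<noteq> 0 \<and> a_reciprocal a f = f"

end

theory Submission
  imports Defs
begin

text \<open>
  Evaluating \<open>f(x) = x\<^sup>n / f(0) * f(a / x)\<close> at a fixed point \<open>x\<close> of \<open>x \<mapsto> a / x\<close>, that is at
  \<open>x = sqrt a\<close> or \<open>x = - sqrt a\<close>, gives \<open>f(x) = x\<^sup>n / f(0) * f(x)\<close>. In both cases the factor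
  \<open>x\<^sup>n / f(0)\<close> equals \<open>-1\<close>, so \<open>f(x)\<close> vanishes because the characteristic is odd.
\<close>

text \<open>Translation by 1 permutes the field, so comparing the sums of \<open>x + 1\<close> and
  of \<open>x\<close> gives \<open>of_nat CARD('k) = 0\<close>. If \<open>2 = 0\<close>, an odd
  cardinality would map to 1 instead.\<close>

lemma two_neq_zero_of_odd_card:
  assumes "odd CARD('k::{field,finite})"
  shows "(2::'k) \<noteq> 0"
proof
  assume "(2::'k) = 0"
  have "(\<Sum>x\<in>UNIV. x + 1 :: 'k) = (\<Sum>x\<in>UNIV. x)"
    by (rule sum.reindex_bij_witness[where i = "\<lambda>x. x - 1" and j = "\<lambda>x. x + 1"]) auto
  then have "of_nat CARD('k) = (0::'k)"
    by (simp add: sum.distrib)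
  moreover obtain m where "CARD('k) = 2 * m + 1"
    using assms by (rule oddE)
  ultimately show False
    using \<open>(2::'k) = 0\<close> by simp
qed

lemma a_self_reciprocal_root:
  fixes f :: "'k::field poly"
  assumes "(2::'k) \<noteq> 0" and "a_self_reciprocal a f"
    and "x \<noteq> 0" and "x ^ 2 = a" and "coeff f 0 = - (x ^ degree f)"
  shows "poly f x = 0"
proof -
  have "a / x = x"
    using assms(3,4) by (simp add: power2_eq_square field_simps)
  then have "poly f x = x ^ degree f / coeff f 0 * poly f x"
    using assms(2) poly_a_reciprocal[OF assms(3), of a f]
    by (simp add: a_self_reciprocal_def poly_0_coeff_0)
  also have "\<dots> = - poly f x"
    using assms(3,5) by simp
  finally have "2 * poly f x = 0"
    by (metis add.right_inverse mult_2)
  with assms(1) show ?thesis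
    by simp
qed

theorem theorem2:
  fixes p e n :: nat
    and a sqrt_a :: "'k::{field,finite}"
    and f :: "'k poly"
  assumes "prime p" and "odd p" and "e > 0" and "CARD('k) = p ^ e"
    and "odd n"
    and "a \<noteq> 0" and "sqrt_a ^ 2 = a"
    and "degree f = n"
    and "a_self_reciprocal a f"
  shows "(coeff f 0 = sqrt_a ^ n \<longrightarrow> [:sqrt_a, 1:] dvd f) \<and>
         (coeff f 0 = - (sqrt_a ^ n) \<longrightarrow> [:- sqrt_a, 1:] dvd f)"
proof -
  have two: "(2::'k) \<noteq> 0"
    using assms(2,4) by (intro two_neq_zero_of_odd_card) simp
  have "sqrt_a \<noteq> 0"
    using assms(6,7) by auto
  \<comment> \<open>Since \<open>n\<close> is odd, \<open>- ((- sqrt_a) ^ n) = sqrt_a ^ n\<close>,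
    as the root criterion requires at \<open>x = - sqrt_a\<close>.\<close>
  then have "poly f (- sqrt_a) = 0" if "coeff f 0 = sqrt_a ^ n"
    using that assms(5,7,8) by (intro a_self_reciprocal_root[OF two assms(9)]) auto
  moreover have "poly f sqrt_a = 0" if "coeff f 0 = - (sqrt_a ^ n)"
    using that assms(7,8) \<open>sqrt_a \<noteq> 0\<close> by (intro a_self_reciprocal_root[OF two assms(9)]) auto
  \<comment> \<open>The root \<open>- sqrt_a\<close> yields the factor
    \<open>[:- (- sqrt_a), 1:]\<close>.\<close>
  ultimately show ?thesis
    by (metis minus_minus poly_eq_0_iff_dvd)
qed

end
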